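(* Let $n \geq 1$, $m \geq 1$ and $k \geq 2$ be integers, let $G$ be an $n$-vertex graph, let $w$ and $w'$ be $m$-weightings of $G$, and let $I$ and $I'$ be independent sets of $G$ with $|I| \leq |I'|$, such that $w(v) = 0$ for each $v \in V(G) \setminus I$ and $w'$ is uniform on $I'$. Then $\pi_k(G(w')) \leq \pi_k(G(w))$.
   Context: All graphs are simple. $\mathbb{N}_0 = \{0,1,2,\dots\}$. For a graph $G$, a function $w: V(G) \to \mathbb{N}_0$ with $\sum_{v \in V(G)} w(v) = m$ is an $m$-weighting of $G$. $G(w)$ is the graph obtained from $G$ by replacing each vertex $v$ by a clique $K^v$ on $w(v)$ vertices and joining every vertex of $K^u$ to every vertex of $K^v$ whenever $uv \in E(G)$. $\pi_k(H)$ denotes the number of $k$-cliques of a graph $H$. An $m$-weighting $w$ is uniform on $U \subseteq V(G)$ if $w(v)=0$ for all $v \notin U$ and $w(u) \in \{\lfloor m/|U|\rfloor, \lceil m/|U| \rceil\}$ for all $u \in U$. *)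

theory Defs
  imports Complex_Main
begin

record 'a ugraph =
  vertices :: "'a set"
  edges :: "'a set set"

definition simple_graph :: "'a ugraph \<Rightarrow> bool" where
  "simple_graph G \<longleftrightarrow> (\<forall>e \<in> edges G. e \<subseteq> vertices G \<and> card e = 2)"

definition independent_set :: "'a ugraph \<Rightarrow> 'a set \<Rightarrow> bool" where
  "independent_set G I \<longleftrightarrow>
     I \<subseteq> vertices G \<and> (\<forall>u \<in> I. \<forall>v \<in> I. u \<noteq> v \<longrightarrow> {u, v} \<notin> edges G)"

definition clique :: "'a ugraph \<Rightarrow> 'a set \<Rightarrow> bool" where
  "clique G K \<longleftrightarrow>
     K \<subseteq> vertices G \<and> (\<forall>u \<in> K. \<forall>v \<in> K. u \<noteq> v \<longrightarrow> {u, v} \<in> edges G)"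

definition num_cliques :: "nat \<Rightarrow> 'a ugraph \<Rightarrow> nat" where
  "num_cliques k G = card {K. clique G K \<and> finite K \<and> card K = k}"

text \<open>A weighting is a total function, but its values outside the vertex set are irrelevant
  to all definitions below.\<close>

definition weighting :: "'a ugraph \<Rightarrow> nat \<Rightarrow> ('a \<Rightarrow> nat) \<Rightarrow> bool" where
  "weighting G m w \<longleftrightarrow> (\<Sum>v \<in> vertices G. w v) = m"

definition uniform_on :: "'a ugraph \<Rightarrow> nat \<Rightarrow> ('a \<Rightarrow> nat) \<Rightarrow> 'a set \<Rightarrow> bool" where
  "uniform_on G m w U \<longleftrightarrow>
     U \<subseteq> vertices G \<and>
     (\<forall>v \<in> vertices G - U. w v = 0) \<and>
     (\<forall>u \<in> U. int (w u) \<in> {\<lfloor>real m / real (card U)\<rfloor>, \<lceil>real m / real (card U)\<rceil>})"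

text \<open>The graph \<open>G(w)\<close>: the clique replacing \<open>v\<close> has vertices \<open>(v, 0), \<dots>, (v, w v - 1)\<close>.\<close>

definition blowup_graph :: "'a ugraph \<Rightarrow> ('a \<Rightarrow> nat) \<Rightarrow> ('a \<times> nat) ugraph" where
  "blowup_graph G w =
     \<lparr> vertices = (SIGMA v : vertices G. {..<w v}),
       edges = {{x, y} | x y.
         x \<in> (SIGMA v : vertices G. {..<w v}) \<and>
         y \<in> (SIGMA v : vertices G. {..<w v}) \<and>
         x \<noteq> y \<and> (fst x = fst y \<or> {fst x, fst y} \<in> edges G)} \<rparr>"

lemma simple_graph_blowup_graph: "simple_graph (blowup_graph G w)"
  by (fastforce simp: simple_graph_def blowup_graph_def card_2_iff)

lemma edge_blowup_graph_iff:
  "{(u, i), (v, j)} \<in> edges (blowup_graph G w) \<longleftrightarrow>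
     u \<in> vertices G \<and> v \<in> vertices G \<and> i < w u \<and> j < w v \<and>
     (u = v \<and> i \<noteq> j \<or> u \<noteq> v \<and> {u, v} \<in> edges G)"
  if "simple_graph G"
proof -
  have "{u} \<notin> edges G" for u
    using that by (auto simp: simple_graph_def)
  then show ?thesis
    by (auto simp: blowup_graph_def doubleton_eq_iff insert_commute)
qed

end

theory Submission
  imports Defs
begin

text \<open>If \<open>w\<close> is supported on an independent set \<open>I\<close>, every clique of \<open>G(w)\<close> lies in a single
  \<open>K\<^sup>v\<close>, so \<open>\<pi>\<^sub>k(G(w))\<close> is the sum of \<open>w v choose k\<close> over \<open>I\<close>. The line through the points
  \<open>(q, q choose k)\<close> and \<open>(q + 1, (q + 1) choose k)\<close> lies below the convex sequence
  \<open>x choose k\<close> on the naturals. With \<open>q = \<lfloor>m/|I'|\<rfloor>\<close> the uniform weighting only takes values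
  where the two agree, and since the line has nonpositive value at \<open>0\<close>, its sum over a
  weighting of total \<open>m\<close> can only increase when passing to a smaller support.\<close>

text \<open>By Pascal's rule the sequence \<open>x choose Suc j\<close> grows by
  \<open>x choose j\<close> from \<open>x\<close> to \<open>x + 1\<close>, and this increment is
  monotone in \<open>x\<close>. Walking away from \<open>q\<close> in either direction therefore
  never falls below the line of slope \<open>q choose j\<close>. Both sides are sums, which avoids
  truncated subtraction.\<close>

lemma binomial_ge_secant:
  fixes q x j :: nat
  shows "(q choose Suc j) + x * (q choose j) \<le> (x choose Suc j) + q * (q choose j)"
proof (cases "q \<le> x")
  case True
  then show ?thesis
  proof (induction x rule: dec_induct)
    case base
    show ?case by simp
  next
    case (step x)
    have "q choose j \<le> x choose j"
      using step.hyps by (intro binomial_right_mono) simp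
    with step.IH show ?case by simp
  qed
next
  case False
  then have "x \<le> q" by simp
  then show ?thesis
  proof (induction x rule: inc_induct)
    case base
    show ?case by simp
  next
    case (step x)
    have "x choose j \<le> q choose j"
      using step.hyps by (intro binomial_right_mono) simp
    with step.IH show ?case by simp
  qed
qed

text \<open>Adjacent vertices over distinct \<open>u\<close> and \<open>v\<close> would force an
  edge between two members of \<open>I\<close>. The case \<open>K = {}\<close> is excluded since the
  empty set is a clique even when \<open>I\<close> is empty.\<close>

lemma clique_blowup_graph_iff:
  assumes "simple_graph G" "independent_set G I" "\<forall>v \<in> vertices G - I. w v = 0" "K \<noteq> {}"
  shows "clique (blowup_graph G w) K \<longleftrightarrow> (\<exists>v\<in>I. K \<subseteq> {v} \<times> {..<w v})"
proof
  assume K: "clique (blowup_graph G w) K"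
  \<comment> \<open>Vertices outside \<open>I\<close> have weight 0, hence empty fibres.\<close>
  have vert: "u \<in> I \<and> i < w u" if "(u, i) \<in> K" for u i
  proof -
    have "u \<in> vertices G" "i < w u"
      using K that by (auto simp: clique_def blowup_graph_def)
    with assms(3) show ?thesis by force
  qed
  have same: "u = v" if "(u, i) \<in> K" "(v, j) \<in> K" for u v i j
  proof (rule ccontr)
    assume "u \<noteq> v"
    then have "{(u, i), (v, j)} \<in> edges (blowup_graph G w)"
      using K that by (auto simp: clique_def)
    then have "{u, v} \<in> edges G"
      using \<open>u \<noteq> v\<close> by (simp add: edge_blowup_graph_iff[OF assms(1)])
    then show False
      using \<open>u \<noteq> v\<close> vert that assms(2) by (auto simp: independent_set_def)
  qed
  obtain v i where "(v, i) \<in> K"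
    using \<open>K \<noteq> {}\<close> by auto
  then show "\<exists>v\<in>I. K \<subseteq> {v} \<times> {..<w v}"
    using vert same by fast
next
  assume "\<exists>v\<in>I. K \<subseteq> {v} \<times> {..<w v}"
  then obtain v where v: "v \<in> I" "K \<subseteq> {v} \<times> {..<w v}"
    by blast
  then have "v \<in> vertices G"
    using assms(2) by (auto simp: independent_set_def)
  then have "K \<subseteq> vertices (blowup_graph G w)"
    using v by (auto simp: blowup_graph_def)
  moreover have "{x, y} \<in> edges (blowup_graph G w)" if "x \<in> K" "y \<in> K" "x \<noteq> y" for x y
  proof -
    obtain i j where "x = (v, i)" "y = (v, j)" "i < w v" "j < w v"
      using v(2) \<open>x \<in> K\<close> \<open>y \<in> K\<close> by blast
    then show ?thesis
      using \<open>x \<noteq> y\<close> \<open>v \<in> vertices G\<close> by (simp add: edge_blowup_graph_iff[OF assms(1)])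
  qed
  ultimately show "clique (blowup_graph G w) K"
    by (simp add: clique_def)
qed

text \<open>The cliques are sorted by the fibre containing them. Since \<open>k \<ge> 1\<close>, a
  clique is nonempty and determines its fibre, so nothing is counted twice.\<close>

lemma num_cliques_blowup_graph_independent:
  assumes "simple_graph G" "independent_set G I" "\<forall>v \<in> vertices G - I. w v = 0"
    and "finite I" "k \<ge> 1"
  shows "num_cliques k (blowup_graph G w) = (\<Sum>v\<in>I. w v choose k)"
proof -
  define S where "S v = {K. K \<subseteq> {v} \<times> {..<w v} \<and> card K = k}" for v
  have fin: "finite (S v)" for v
    by (rule finite_subset[of _ "Pow ({v} \<times> {..<w v})"]) (auto simp: S_def)
  have ne: "K \<noteq> {}" if "card K = k" for K :: "('a \<times> nat) set"
    using that \<open>k \<ge> 1\<close> by auto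
  have "{K. clique (blowup_graph G w) K \<and> finite K \<and> card K = k} = (\<Union>v\<in>I. S v)"
  proof (rule set_eqI)
    fix K
    have "finite K" if "K \<subseteq> {v} \<times> {..<w v}" for v
      using that by (rule finite_subset) simp
    moreover have "clique (blowup_graph G w) K \<longleftrightarrow> (\<exists>v\<in>I. K \<subseteq> {v} \<times> {..<w v})" if "card K = k"
      using ne[OF that] by (rule clique_blowup_graph_iff[OF assms(1-3)])
    ultimately show "K \<in> {K. clique (blowup_graph G w) K \<and> finite K \<and> card K = k} \<longleftrightarrow>
        K \<in> (\<Union>v\<in>I. S v)"
      unfolding S_def by blast
  qed
  moreover have "card (\<Union>v\<in>I. S v) = (\<Sum>v\<in>I. card (S v))"
  proof (rule card_UN_disjoint)
    have "S u \<inter> S v = {}" if "u \<noteq> v" for u v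
    proof (rule equals0I)
      fix K assume "K \<in> S u \<inter> S v"
      then have "K \<subseteq> {u} \<times> UNIV" "K \<subseteq> {v} \<times> UNIV" "K \<noteq> {}"
        using ne by (auto simp: S_def)
      with \<open>u \<noteq> v\<close> show False by blast
    qed
    then show "\<forall>u\<in>I. \<forall>v\<in>I. u \<noteq> v \<longrightarrow> S u \<inter> S v = {}" by blast
  qed (use \<open>finite I\<close> fin in auto)
  moreover have "card (S v) = w v choose k" for v
    by (simp add: S_def n_subsets card_cartesian_product)
  ultimately show ?thesis
    by (simp add: num_cliques_def)
qed

lemma sum_binomial_near_constant_le:
  fixes w :: "'a \<Rightarrow> nat" and w' :: "'b \<Rightarrow> nat"
  assumes "card I \<le> card I'" "sum w I = sum w' I'"
    and near: "\<And>v. v \<in> I' \<Longrightarrow> w' v \<in> {q, Suc q}"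
  shows "(\<Sum>v\<in>I'. w' v choose Suc j) \<le> (\<Sum>v\<in>I. w v choose Suc j)"
proof -
  \<comment> \<open>The line has slope \<open>a\<close> and height \<open>b\<close> at
    \<open>q\<close>. Its intercept \<open>b - q * a\<close> may be negative, hence the
    integers.\<close>
  define a b where "a = int (q choose j)" and "b = int (q choose Suc j)"
  have below: "b - q * a + x * a \<le> int (x choose Suc j)" for x :: nat
  proof -
    have "int ((q choose Suc j) + x * (q choose j)) \<le> int ((x choose Suc j) + q * (q choose j))"
      using binomial_ge_secant by (simp only: of_nat_le_iff)
    then show ?thesis by (simp add: a_def b_def)
  qed
  \<comment> \<open>The line is exact at \<open>q\<close>, and at \<open>Suc q\<close> by Pascal's
    rule.\<close>
  have "(\<Sum>v\<in>I'. int (w' v choose Suc j)) = (\<Sum>v\<in>I'. b - q * a + w' v * a)"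
    by (intro sum.cong refl) (use near in \<open>fastforce simp: a_def b_def algebra_simps\<close>)
  also have "\<dots> = card I' * (b - q * a) + int (sum w' I') * a"
    by (simp only: sum.distrib sum_distrib_right sum_constant of_nat_sum)
  \<comment> \<open>The slope terms agree because the totals do. The intercept is at most
    \<open>0 choose Suc j = 0\<close>, so the larger factor \<open>card I'\<close> gives the smaller
    product.\<close>
  also have "\<dots> \<le> card I * (b - q * a) + int (sum w I) * a"
    using below[of 0] assms(1,2) by (simp add: mult_right_mono_neg)
  also have "\<dots> = (\<Sum>v\<in>I. b - q * a + w v * a)"
    by (simp only: sum.distrib sum_distrib_right sum_constant of_nat_sum)
  also have "\<dots> \<le> (\<Sum>v\<in>I. int (w v choose Suc j))"
    by (intro sum_mono below)
  finally show ?thesis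
    by (simp only: of_nat_sum[symmetric] of_nat_le_iff)
qed

text \<open>A ceiling exceeds the floor by at most one, so \<open>q = m div card U\<close> serves
  all of \<open>U\<close> at once.\<close>

lemma uniform_on_cases:
  assumes "uniform_on G m w U" "u \<in> U"
  shows "w u \<in> {m div card U, Suc (m div card U)}"
proof -
  let ?x = "real m / real (card U)"
  have "int (w u) \<in> {\<lfloor>?x\<rfloor>, \<lceil>?x\<rceil>}"
    using assms by (auto simp: uniform_on_def)
  moreover have "\<lfloor>?x\<rfloor> = int (m div card U)"
    by (rule floor_divide_of_nat_eq)
  moreover have "\<lceil>?x\<rceil> \<in> {\<lfloor>?x\<rfloor>, \<lfloor>?x\<rfloor> + 1}"
    by (simp add: ceiling_altdef)
  ultimately show ?thesis by auto
qed

lemma weighting_sum_support: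
  assumes "weighting G m w" "finite (vertices G)" "I \<subseteq> vertices G"
    and "\<forall>v \<in> vertices G - I. w v = 0"
  shows "sum w I = m"
  using assms sum.mono_neutral_left[of "vertices G" I w] by (simp add: weighting_def)

theorem lemma2:
  fixes G :: "'a ugraph" and n m k :: nat and w w' :: "'a \<Rightarrow> nat" and I I' :: "'a set"
  assumes "n \<ge> 1" and "m \<ge> 1" and "k \<ge> 2"
    and "simple_graph G" and "finite (vertices G)" and "card (vertices G) = n"
    and "weighting G m w" and "weighting G m w'"
    and "independent_set G I" and "independent_set G I'" and "card I \<le> card I'"
    and "\<forall>v \<in> vertices G - I. w v = 0"
    and "uniform_on G m w' I'"
  shows "num_cliques k (blowup_graph G w') \<le> num_cliques k (blowup_graph G w)"
proof -
  have sub: "I \<subseteq> vertices G" "I' \<subseteq> vertices G"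
    using assms(9,10) by (auto simp: independent_set_def)
  have fin: "finite I" "finite I'"
    using sub assms(5) by (auto intro: finite_subset)
  have zero': "\<forall>v \<in> vertices G - I'. w' v = 0"
    using assms(13) by (simp add: uniform_on_def)
  have sums: "sum w I = sum w' I'"
    using weighting_sum_support[OF assms(7,5) sub(1) assms(12)]
      weighting_sum_support[OF assms(8,5) sub(2) zero'] by simp
  \<comment> \<open>The slope of the line is then \<open>q choose j\<close>, with no predecessor of
    \<open>k\<close> to handle.\<close>
  obtain j where k: "k = Suc j"
    using \<open>k \<ge> 2\<close> by (cases k) auto
  have "(\<Sum>v\<in>I'. w' v choose k) \<le> (\<Sum>v\<in>I. w v choose k)"
    unfolding k
    by (rule sum_binomial_near_constant_le[OF assms(11) sums uniform_on_cases[OF assms(13)]])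
  then show ?thesis
    using \<open>k \<ge> 2\<close> num_cliques_blowup_graph_independent[OF assms(4,9,12) fin(1)]
      num_cliques_blowup_graph_independent[OF assms(4,10) zero' fin(2)] by simp
qed

end
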